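(* Every $CT_3$-space is a strict Fréchet-Urysohn space.
   Context: All topological spaces are assumed to be $T_1$ and non-empty. For a space $X$, $\mathrm{Cld}(X)$ denotes the set of all non-empty closed subsets of $X$, endowed with the Vietoris topology, i.e. the topology having as a subbase all sets $U^-=\{F\in\mathrm{Cld}(X): F\cap U\neq\emptyset\}$ and $U^+=\{F\in\mathrm{Cld}(X): F\subseteq U\}$ with $U$ open in $X$. Let $\mathcal{T}_3(X)=\{(F_1,F_2)\in\mathrm{Cld}(X)^2: F_1\cap F_2=\emptyset,\ F_1 \text{ is a singleton}\}$, with the subspace topology from the product space $\mathrm{Cld}(X)^2$. The space $X$ is called $CT_3$ if there is a continuous map $\phi=(\phi_1,\phi_2):\mathcal{T}_3(X)\to\mathrm{Cld}(X)^2$ such that for every $(F_1,F_2)\in\mathcal{T}_3(X)$: $\phi_1(F_1,F_2)\cup\phi_2(F_1,F_2)=X$ and $F_j\cap\phi_j(F_1,F_2)=\emptyset$ for $j=1,2$. A Hausdorff space $X$ is called a strict Fréchet-Urysohn space if for each sequence $(A_n)$ of subsets of $X$ and each point $x\in X$ that is an accumulation point of every $A_n$, there exists a sequence $(x_n)$ in $X$ such that $x_n\in A_n$ for all $n$ and $x_n\to x$. *)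

theory Defs
  imports "HOL-Analysis.Analysis"
begin

definition Cld :: "'a topology \<Rightarrow> 'a set set" where
  "Cld X = {F. closedin X F \<and> F \<noteq> {}}"

definition vietoris_minus :: "'a topology \<Rightarrow> 'a set \<Rightarrow> 'a set set" where
  "vietoris_minus X U = {F \<in> Cld X. F \<inter> U \<noteq> {}}"

definition vietoris_plus :: "'a topology \<Rightarrow> 'a set \<Rightarrow> 'a set set" where
  "vietoris_plus X U = {F \<in> Cld X. F \<subseteq> U}"

definition vietoris :: "'a topology \<Rightarrow> 'a set topology" where
  "vietoris X = topology_generated_by
     ({vietoris_minus X U | U. openin X U} \<union> {vietoris_plus X U | U. openin X U})"

lemma topspace_vietoris: "topspace (vietoris X) = Cld X"
proof
  show "topspace (vietoris X) \<subseteq> Cld X"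
    unfolding vietoris_def topology_generated_by_topspace
    by (auto simp: vietoris_minus_def vietoris_plus_def)
  have "Cld X = vietoris_plus X (topspace X)"
    by (auto simp: Cld_def vietoris_plus_def dest: closedin_subset)
  then show "Cld X \<subseteq> topspace (vietoris X)"
    unfolding vietoris_def topology_generated_by_topspace
    using openin_topspace by blast
qed

definition T3_pairs :: "'a topology \<Rightarrow> ('a set \<times> 'a set) set" where
  "T3_pairs X = {(F\<^sub>1, F\<^sub>2). F\<^sub>1 \<in> Cld X \<and> F\<^sub>2 \<in> Cld X \<and> F\<^sub>1 \<inter> F\<^sub>2 = {} \<and> is_singleton F\<^sub>1}"

(* The standing assumptions that X is T_1 and non-empty are not part of this definition. *)
definition CT3_space :: "'a topology \<Rightarrow> bool" where
  "CT3_space X \<longleftrightarrow>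
     (\<exists>\<phi>\<^sub>1 \<phi>\<^sub>2.
        continuous_map
          (subtopology (prod_topology (vietoris X) (vietoris X)) (T3_pairs X))
          (prod_topology (vietoris X) (vietoris X))
          (\<lambda>p. (\<phi>\<^sub>1 p, \<phi>\<^sub>2 p)) \<and>
        (\<forall>(F\<^sub>1, F\<^sub>2) \<in> T3_pairs X.
           \<phi>\<^sub>1 (F\<^sub>1, F\<^sub>2) \<union> \<phi>\<^sub>2 (F\<^sub>1, F\<^sub>2) = topspace X \<and>
           F\<^sub>1 \<inter> \<phi>\<^sub>1 (F\<^sub>1, F\<^sub>2) = {} \<and>
           F\<^sub>2 \<inter> \<phi>\<^sub>2 (F\<^sub>1, F\<^sub>2) = {}))"

definition strict_Frechet_Urysohn_space :: "'a topology \<Rightarrow> bool" where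
  "strict_Frechet_Urysohn_space X \<longleftrightarrow>
     Hausdorff_space X \<and>
     (\<forall>A :: nat \<Rightarrow> 'a set. \<forall>x \<in> topspace X.
        (\<forall>n. A n \<subseteq> topspace X) \<longrightarrow> (\<forall>n. x \<in> X derived_set_of A n) \<longrightarrow>
        (\<exists>s :: nat \<Rightarrow> 'a. (\<forall>n. s n \<in> A n) \<and> limitin X s x sequentially))"

end

theory Submission
  imports Defs
begin

text \<open>
  Let \<open>(\<phi>\<^sub>1, \<phi>\<^sub>2)\<close> witness that \<open>X\<close> is \<open>CT\<^sub>3\<close> and fix a point \<open>x\<close>. For a non-empty closed set
  \<open>F\<close> that misses \<open>x\<close>, put \<open>P F = \<phi>\<^sub>2 ({x}, F)\<close> and let \<open>W F\<close> be the complement of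
  \<open>\<phi>\<^sub>1 ({x}, F)\<close>. Then \<open>W F\<close> is an open neighbourhood of \<open>x\<close> contained in the closed set
  \<open>P F\<close>, which is disjoint from \<open>F\<close>, and \<open>P\<close> is continuous in the Vietoris topology. Taking
  \<open>F = {y}\<close>, the sets \<open>W F\<close> and \<open>X - P F\<close> show that \<open>X\<close> is Hausdorff.

  Suppose that \<open>x\<close> is an accumulation point of every \<open>A n\<close>. Finite sets are closed, so the terms
  \<open>s n \<in> A n - {x}\<close> can be chosen recursively so that \<open>s n\<close> lies in \<open>W S\<close> for each of the finitely
  many non-empty sets \<open>S\<close> of earlier terms. This property passes to subsequences, so for
  \<open>s \<longlonglongrightarrow> x\<close> it suffices that \<open>x\<close> lies in the closure \<open>F\<close> of the range of every such sequence
  (lemma \<open>closure_of_range_if_escaping\<close>). If it did not, then the finite sets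
  \<open>s ` {..n}\<close> would converge to \<open>F\<close> in the Vietoris topology, and continuity of \<open>P\<close> at \<open>F\<close> would
  give \<open>P (s ` {..n}) \<subseteq> X - F\<close> for large \<open>n\<close>. But \<open>s (Suc n)\<close> lies in
  \<open>W (s ` {..n}) \<subseteq> P (s ` {..n})\<close> and in \<open>F\<close>.
\<close>

lemma openin_vietoris_plus: "openin X U \<Longrightarrow> openin (vietoris X) (vietoris_plus X U)"
  unfolding vietoris_def by (rule topology_generated_by_Basis) auto

lemma limitin_topology_generated_by:
  assumes "l \<in> topspace (topology_generated_by B)"
    and "\<And>U. U \<in> B \<Longrightarrow> l \<in> U \<Longrightarrow> eventually (\<lambda>i. f i \<in> U) \<F>"
  shows "limitin (topology_generated_by B) f l \<F>"
proof -
  have "l \<in> U \<longrightarrow> eventually (\<lambda>i. f i \<in> U) \<F>" if "generate_topology_on B U" for U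
    using that
  proof induction
    case (Int a b)
    then show ?case by (auto intro: eventually_conj)
  next
    case (UN K)
    show ?case
    proof
      assume "l \<in> \<Union>K"
      then obtain k where k: "k \<in> K" "l \<in> k" by blast
      with UN have "eventually (\<lambda>i. f i \<in> k) \<F>" by blast
      then show "eventually (\<lambda>i. f i \<in> \<Union>K) \<F>"
        by (rule eventually_mono) (use k in blast)
    qed
  qed (use assms(2) in auto)
  with assms(1) show ?thesis
    by (auto simp: limitin_def openin_topology_generated_by_iff)
qed

lemma limitin_vietoris_incseq:
  assumes "incseq S" and S: "\<And>n. S n \<in> Cld X"
  shows "limitin (vietoris X) S (X closure_of (\<Union>n. S n)) sequentially"
proof -
  let ?F = "X closure_of (\<Union>n. S n)"
  have "\<Union> (range S) \<subseteq> topspace X"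
    using S by (auto simp: Cld_def dest: closedin_subset)
  then have sub: "S n \<subseteq> ?F" for n
    using closure_of_subset by fastforce
  have "?F \<noteq> {}"
    using sub[of 0] S[of 0] by (auto simp: Cld_def)
  show ?thesis
    unfolding vietoris_def
  proof (rule limitin_topology_generated_by)
    show "?F \<in> topspace (topology_generated_by
        ({vietoris_minus X U |U. openin X U} \<union> {vietoris_plus X U |U. openin X U}))"
      using \<open>?F \<noteq> {}\<close> topspace_vietoris[of X] by (simp add: vietoris_def Cld_def)
  next
    fix B
    assume "B \<in> {vietoris_minus X U |U. openin X U} \<union> {vietoris_plus X U |U. openin X U}"
      and F: "?F \<in> B"
    then consider U where "openin X U" "B = vietoris_minus X U"
      | U where "openin X U" "B = vietoris_plus X U"
      by blast
    then show "eventually (\<lambda>n. S n \<in> B) sequentially"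
    proof cases
      case 1
      then have "U \<inter> ?F \<noteq> {}"
        using F by (auto simp: vietoris_minus_def)
      then obtain n where "U \<inter> S n \<noteq> {}"
        using openin_Int_closure_of_eq_empty[OF 1(1), of "\<Union>n. S n"] by auto
      then have "S m \<in> B" if "n \<le> m" for m
        using incseqD[OF assms(1) that] S[of m] 1 by (auto simp: vietoris_minus_def)
      then show ?thesis
        by (auto simp: eventually_sequentially)
    next
      case 2
      then show ?thesis
        using F sub S by (intro always_eventually) (auto simp: vietoris_plus_def)
    qed
  qed
qed

text \<open>
  The form in which the hypothesis is used: \<open>P\<close> is the second component of the \<open>CT\<^sub>3\<close> map
  with first argument \<open>{x}\<close>, and \<open>W F\<close> is the complement of the first component.
\<close>

lemma CT3_space_at_point:
  assumes "CT3_space X" "t1_space X" "x \<in> topspace X"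
  shows "\<exists>P W. continuous_map (subtopology (vietoris X) {F. x \<notin> F}) (vietoris X) P \<and>
    (\<forall>F \<in> Cld X. x \<notin> F \<longrightarrow>
        openin X (W F) \<and> x \<in> W F \<and> W F \<subseteq> P F \<and> F \<inter> P F = {} \<and> closedin X (P F))"
proof -
  let ?V = "vietoris X"
  let ?T = "subtopology (prod_topology ?V ?V) (T3_pairs X)"
  let ?H = "subtopology ?V {F. x \<notin> F}"
  obtain \<phi>\<^sub>1 \<phi>\<^sub>2 where
    cont: "continuous_map ?T (prod_topology ?V ?V) (\<lambda>p. (\<phi>\<^sub>1 p, \<phi>\<^sub>2 p))"
    and sep: "\<And>E F. (E, F) \<in> T3_pairs X \<Longrightarrow>
      \<phi>\<^sub>1 (E, F) \<union> \<phi>\<^sub>2 (E, F) = topspace X \<and> E \<inter> \<phi>\<^sub>1 (E, F) = {} \<and> F \<inter> \<phi>\<^sub>2 (E, F) = {}"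
    using assms(1) unfolding CT3_space_def by fast
  have x: "{x} \<in> Cld X"
    using assms(2,3) by (simp add: Cld_def closedin_t1_singleton)
  have pair: "({x}, F) \<in> T3_pairs X" if "F \<in> Cld X" "x \<notin> F" for F
    using that x by (auto simp: T3_pairs_def)
  have "continuous_map ?H ?T (\<lambda>F. ({x}, F))"
    using x pair
    by (auto simp: continuous_map_in_subtopology continuous_map_pairedI topspace_vietoris
        intro!: continuous_map_from_subtopology continuous_map_pairedI)
  then have cont': "continuous_map ?H (prod_topology ?V ?V) (\<lambda>F. (\<phi>\<^sub>1 ({x}, F), \<phi>\<^sub>2 ({x}, F)))"
    using continuous_map_compose[OF _ cont] by (auto simp: o_def)
  then have c1: "continuous_map ?H ?V (\<lambda>F. \<phi>\<^sub>1 ({x}, F))"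
    and c2: "continuous_map ?H ?V (\<lambda>F. \<phi>\<^sub>2 ({x}, F))"
    by (auto simp: o_def continuous_map_pairwise)
  have cl: "closedin X (\<phi>\<^sub>1 ({x}, F))" "closedin X (\<phi>\<^sub>2 ({x}, F))"
    if "F \<in> Cld X" "x \<notin> F" for F
    using continuous_map_funspace[OF c1] continuous_map_funspace[OF c2] that
    by (auto simp: topspace_vietoris Cld_def Pi_iff)
  show ?thesis
  proof (intro exI conjI ballI impI)
    fix F assume F: "F \<in> Cld X" "x \<notin> F"
    note sep[OF pair[OF F]] cl[OF F]
    then show "openin X (topspace X - \<phi>\<^sub>1 ({x}, F))" "x \<in> topspace X - \<phi>\<^sub>1 ({x}, F)"
      "topspace X - \<phi>\<^sub>1 ({x}, F) \<subseteq> \<phi>\<^sub>2 ({x}, F)" "F \<inter> \<phi>\<^sub>2 ({x}, F) = {}"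
      "closedin X (\<phi>\<^sub>2 ({x}, F))"
      using assms(3) by auto
  qed (fact c2)
qed

lemma finite_in_Cld:
  assumes "t1_space X" "finite S" "S \<noteq> {}" "S \<subseteq> topspace X"
  shows "S \<in> Cld X"
  using assms by (simp add: Cld_def t1_space_closedin_finite)

lemma CT3_imp_Hausdorff_space:
  assumes "CT3_space X" "t1_space X"
  shows "Hausdorff_space X"
  unfolding Hausdorff_space_def
proof (intro allI impI, elim conjE)
  fix x y assume xy: "x \<in> topspace X" "y \<in> topspace X" "x \<noteq> y"
  then have y: "{y} \<in> Cld X" "x \<notin> {y}"
    using finite_in_Cld[OF assms(2), of "{y}"] by auto
  then obtain U C where "openin X U" "x \<in> U" "U \<subseteq> C" "{y} \<inter> C = {}" "closedin X C"
    using CT3_space_at_point[OF assms xy(1)] by meson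
  then show "\<exists>U V. openin X U \<and> openin X V \<and> x \<in> U \<and> y \<in> V \<and> disjnt U V"
    using xy by (intro exI[of _ U] exI[of _ "topspace X - C"]) (auto simp: disjnt_def)
qed

text \<open>
  The core of the argument: if each term lies in the set \<open>P\<close> of the finite set of its
  predecessors, then the sequence cannot stay away from \<open>x\<close>. Otherwise the closure \<open>F\<close> of its
  range avoids \<open>P F\<close>, and by continuity it avoids \<open>P (s ` {..n})\<close> for large \<open>n\<close>, which
  contains \<open>s (Suc n)\<close>.
\<close>

lemma closure_of_range_if_escaping:
  assumes "t1_space X"
    and cont: "continuous_map (subtopology (vietoris X) {F. x \<notin> F}) (vietoris X) P"
    and disj: "\<And>F. F \<in> Cld X \<Longrightarrow> x \<notin> F \<Longrightarrow> F \<inter> P F = {}"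
    and s: "\<And>n. s n \<in> topspace X - {x}"
    and escape: "\<And>n. s (Suc n) \<in> P (s ` {..n})"
  shows "x \<in> X closure_of range s"
proof (rule ccontr)
  let ?V = "vietoris X"
  define F where "F = X closure_of range s"
  assume "x \<notin> X closure_of range s"
  then have x: "x \<notin> F" by (simp add: F_def)
  have sF: "range s \<subseteq> F"
    unfolding F_def using s by (intro closure_of_subset) auto
  then have F: "F \<in> Cld X"
    by (auto simp: Cld_def F_def)
  have S: "s ` {..n} \<in> Cld X" for n
    using s by (intro finite_in_Cld assms) auto
  have "(\<Union>n. s ` {..n}) = range s" by auto
  moreover have "incseq (\<lambda>n. s ` {..n})"
    by (intro monoI image_mono) auto
  ultimately have "limitin ?V (\<lambda>n. s ` {..n}) F sequentially"
    using limitin_vietoris_incseq[of "\<lambda>n. s ` {..n}", OF _ S] by (simp add: F_def)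
  moreover have "x \<notin> s ` {..n}" for n
    using s by blast
  ultimately have "limitin (subtopology ?V {F. x \<notin> F}) (\<lambda>n. s ` {..n}) F sequentially"
    using x by (simp add: limitin_subtopology)
  from continuous_map_limit[OF cont this]
  have lim: "limitin ?V (P \<circ> (\<lambda>n. s ` {..n})) (P F) sequentially"
    by simp
  have PF: "P F \<in> Cld X"
    using limitin_topspace[OF lim] by (simp add: topspace_vietoris)
  \<comment> \<open>As \<open>P F\<close> misses the closed set \<open>F\<close>, the closed sets disjoint from \<open>F\<close> form a
    Vietoris neighbourhood of \<open>P F\<close>.\<close>
  have "openin X (topspace X - F)"
    by (simp add: F_def openin_diff)
  moreover from this have "P F \<in> vietoris_plus X (topspace X - F)"
    using PF disj[OF F x] by (auto simp: vietoris_plus_def Cld_def dest: closedin_subset)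
  ultimately have "eventually (\<lambda>n. P (s ` {..n}) \<in> vietoris_plus X (topspace X - F)) sequentially"
    using limitinD[OF lim openin_vietoris_plus] by (simp only: o_def)
  then have "\<exists>n. P (s ` {..n}) \<in> vietoris_plus X (topspace X - F)"
    by (rule eventually_happens'[OF sequentially_bot])
  then obtain n where "P (s ` {..n}) \<subseteq> topspace X - F"
    unfolding vietoris_plus_def by blast
  then show False
    using escape[of n] sF by blast
qed

text \<open>
  Membership in \<open>W S\<close> is demanded for all non-empty sets \<open>S\<close> of earlier terms, and not only
  for the set of all of them, so that the property is inherited by subsequences.
\<close>

lemma exists_escaping_sequence:
  assumes W: "\<And>S. finite S \<Longrightarrow> S \<noteq> {} \<Longrightarrow> S \<subseteq> topspace X - {x} \<Longrightarrow> openin X (W S) \<and> x \<in> W S"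
    and x: "\<And>n. x \<in> X derived_set_of A n"
    and A: "\<And>n. A n \<subseteq> topspace X"
  obtains s :: "nat \<Rightarrow> 'a" where "\<And>n. s n \<in> A n - {x}"
    "\<And>n S. S \<subseteq> s ` {..<n} \<Longrightarrow> S \<noteq> {} \<Longrightarrow> s n \<in> W S"
proof -
  let ?Q = "\<lambda>s n r. r \<in> A n - {x} \<and> (\<forall>S \<subseteq> s ` {..<n}. S \<noteq> {} \<longrightarrow> r \<in> W S)"
  have "\<exists>s. \<forall>n. ?Q s n (s n)"
  proof (rule dependent_wellorder_choice)
    fix r and f g :: "nat \<Rightarrow> 'a" and n
    assume "\<And>m. m < n \<Longrightarrow> f m = g m"
    then have "f ` {..<n} = g ` {..<n}" by (auto intro!: image_cong)
    then show "?Q f n r = ?Q g n r" by simp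
  next
    fix n :: nat and s assume IH: "\<And>m. m < n \<Longrightarrow> ?Q s m (s m)"
    define \<S> where "\<S> = {S. S \<subseteq> s ` {..<n} \<and> S \<noteq> {}}"
    have "s m \<in> topspace X - {x}" if "m < n" for m
      using IH[OF that] A[of m] by blast
    then have s: "s ` {..<n} \<subseteq> topspace X - {x}" by blast
    have "openin X (W S) \<and> x \<in> W S" if "S \<in> \<S>" for S
    proof (rule W)
      show "finite S" "S \<noteq> {}" "S \<subseteq> topspace X - {x}"
        using that s finite_subset[of S "s ` {..<n}"] unfolding \<S>_def by (simp_all, blast)
    qed
    moreover have "finite \<S>" by (simp add: \<S>_def)
    moreover have "x \<in> topspace X"
      using x[of n] by (simp add: in_derived_set_of)
    ultimately have "openin X (topspace X \<inter> \<Inter> (W ` \<S>))" "x \<in> topspace X \<inter> \<Inter> (W ` \<S>)"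
      by (auto intro!: openin_Int_Inter)
    then obtain y where "y \<noteq> x" "y \<in> A n" "y \<in> topspace X \<inter> \<Inter> (W ` \<S>)"
      using x[of n] unfolding in_derived_set_of by blast
    then show "\<exists>r. ?Q s n r"
      by (intro exI[of _ y]) (auto simp: \<S>_def)
  qed
  then obtain s where s: "\<And>n. ?Q s n (s n)" by metis
  show ?thesis
    by (rule that[of s]) (use s in blast)+
qed

theorem theorem5p7:
  fixes X :: "'a topology"
  assumes "t1_space X"
    and "topspace X \<noteq> {}"
    and "CT3_space X"
  shows "strict_Frechet_Urysohn_space X"
  unfolding strict_Frechet_Urysohn_space_def
proof (intro conjI allI ballI impI)
  show "Hausdorff_space X"
    using CT3_imp_Hausdorff_space assms by blast
next
  fix A :: "nat \<Rightarrow> 'a set" and x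
  assume xX: "x \<in> topspace X" and A: "\<forall>n. A n \<subseteq> topspace X"
    and der: "\<forall>n. x \<in> X derived_set_of A n"
  obtain P W where
    cont: "continuous_map (subtopology (vietoris X) {F. x \<notin> F}) (vietoris X) P"
    and PW: "\<forall>F \<in> Cld X. x \<notin> F \<longrightarrow>
      openin X (W F) \<and> x \<in> W F \<and> W F \<subseteq> P F \<and> F \<inter> P F = {} \<and> closedin X (P F)"
    using CT3_space_at_point[OF assms(3,1) xX] by (elim exE conjE)
  have fin: "S \<in> Cld X" "x \<notin> S" if "finite S" "S \<noteq> {}" "S \<subseteq> topspace X - {x}" for S
    using finite_in_Cld[OF assms(1)] that by auto
  obtain s where sA: "\<And>n. s n \<in> A n - {x}"
    and sW: "\<And>n S. S \<subseteq> s ` {..<n} \<Longrightarrow> S \<noteq> {} \<Longrightarrow> s n \<in> W S"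
  proof (rule exists_escaping_sequence[of X x W A])
    show "openin X (W S) \<and> x \<in> W S"
      if "finite S" "S \<noteq> {}" "S \<subseteq> topspace X - {x}" for S
      using fin[OF that] PW by blast
  qed (use der A in auto)
  have s: "s n \<in> topspace X - {x}" for n
    using sA A by blast
  have subseq: "x \<in> X closure_of range (s \<circ> r)" if r: "strict_mono r" for r :: "nat \<Rightarrow> nat"
  proof (rule closure_of_range_if_escaping[OF assms(1) cont])
    show "F \<inter> P F = {}" if "F \<in> Cld X" "x \<notin> F" for F
      using PW that by blast
    show "(s \<circ> r) n \<in> topspace X - {x}" for n
      using s by simp
    fix n
    let ?S = "(s \<circ> r) ` {..n}"
    have "r k < r (Suc n)" if "k \<le> n" for k
      using that r by (simp add: strict_mono_less)
    then have "(s \<circ> r) (Suc n) \<in> W ?S"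
      unfolding o_apply by (intro sW) auto
    moreover have "?S \<in> Cld X" "x \<notin> ?S"
      using s by (intro fin; auto)+
    ultimately show "(s \<circ> r) (Suc n) \<in> P ?S"
      using PW by blast
  qed
  have "limitin X s x sequentially"
    unfolding limitin_def
  proof (intro conjI allI impI, fact xX, elim conjE)
    fix U assume U: "openin X U" "x \<in> U"
    show "eventually (\<lambda>n. s n \<in> U) sequentially"
    proof (rule ccontr)
      assume "\<not> eventually (\<lambda>n. s n \<in> U) sequentially"
      then have "infinite {n. s n \<notin> U}"
        by (simp add: eventually_cofinite flip: cofinite_eq_sequentially)
      \<comment> \<open>The terms outside \<open>U\<close> form a subsequence, which by \<open>subseq\<close> must enter \<open>U\<close>.\<close>
      then obtain r :: "nat \<Rightarrow> nat" where r: "strict_mono r" "\<forall>n. r n \<in> {n. s n \<notin> U}"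
        using infinite_enumerate by meson
      obtain n where "s (r n) \<in> U"
        using subseq[OF r(1)] U unfolding in_closure_of by auto
      with r(2) show False by blast
    qed
  qed
  then show "\<exists>s. (\<forall>n. s n \<in> A n) \<and> limitin X s x sequentially"
    using sA by blast
qed

end
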